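(* Let $f(x)=F(x,e^{h(x)})$, where $F\in\mathbb{Z}[X,Y]$, $F\ne 0$, and $h\in\mathbb{Z}[X]$ satisfy $\deg(F)\le d$, $\deg(h)=\delta>0$ and $H(F),H(h)\le H$. Then every zero $\alpha\in\mathbb{R}$ of $f$ satisfies $$|\alpha|\le 1+(d+1)\,H^2\,\max\left\{(d+1)(1+2H^2),\ 2\cdot\left(\left\lfloor \tfrac{2d}{\delta}+1\right\rfloor !\right)\right\}.$$
   Context: For a polynomial with integer coefficients, $H(\cdot)$ denotes its height, i.e. the maximum of the absolute values of its coefficients. $\deg(F)$ is the total degree of $F$. *)

theory Defs
  imports Complex_Main "HOL-Computational_Algebra.Polynomial"
begin

text \<open>
  A bivariate polynomial \<open>F\<close> in the variables \<open>X\<close> and \<open>Y\<close> is represented in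
  the ring of polynomials in \<open>Y\<close> over the polynomials in \<open>X\<close>, so that
  \<open>coeff (coeff F j) i\<close> is the coefficient of \<open>X ^ i * Y ^ j\<close>.
\<close>

definition eval_bipoly :: "int poly poly \<Rightarrow> real \<Rightarrow> real \<Rightarrow> real" where
  "eval_bipoly F x y = poly (map_poly (\<lambda>c. poly (map_poly of_int c) x) F) y"

text \<open>The \<open>insert 0\<close> only matters for \<open>F = 0\<close>.\<close>

definition total_degree :: "int poly poly \<Rightarrow> nat" where
  "total_degree F = Max (insert 0 {i + j | i j. coeff (coeff F j) i \<noteq> 0})"

definition height :: "int poly \<Rightarrow> int" where
  "height p = Max (range (\<lambda>i. \<bar>coeff p i\<bar>))"

definition height_bipoly :: "int poly poly \<Rightarrow> int" where
  "height_bipoly F = Max (range (\<lambda>(i, j). \<bar>coeff (coeff F j) i\<bar>))"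

text \<open>
  \<open>Max\<close> is only meaningful on finite nonempty sets; all the sets above are finite.
\<close>

lemma finite_nonzero_bicoeffs:
  "finite {(i, j). coeff (coeff F j) i \<noteq> (0 :: int)}"
proof (rule finite_subset)
  let ?S = "SIGMA j:{..degree F}. {..degree (coeff F j)}"
  show "{(i, j). coeff (coeff F j) i \<noteq> 0} \<subseteq> (\<lambda>(j, i). (i, j)) ` ?S"
  proof clarify
    fix i j assume nz: "coeff (coeff F j) i \<noteq> 0"
    then have "coeff F j \<noteq> 0" by auto
    with nz have "(j, i) \<in> ?S" by (auto intro: le_degree)
    then show "(i, j) \<in> (\<lambda>(j, i). (i, j)) ` ?S" by force
  qed
  show "finite ((\<lambda>(j, i). (i, j)) ` ?S)" by simp
qed

lemma finite_total_degree_set: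
  "finite {i + j | i j. coeff (coeff F j) i \<noteq> (0 :: int)}"
proof -
  have "{i + j | i j. coeff (coeff F j) i \<noteq> 0} =
      (\<lambda>(i, j). i + j) ` {(i, j). coeff (coeff F j) i \<noteq> 0}"
    by auto
  then show ?thesis using finite_nonzero_bicoeffs[of F] by simp
qed

lemma finite_abs_coeffs: "finite (range (\<lambda>i. \<bar>coeff p i :: int\<bar>))"
proof (rule finite_subset)
  show "range (\<lambda>i. \<bar>coeff p i\<bar>) \<subseteq> insert 0 ((\<lambda>i. \<bar>coeff p i\<bar>) ` {..degree p})"
    using le_degree[of p] by fastforce
qed simp

lemma finite_abs_bicoeffs:
  "finite (range (\<lambda>(i, j). \<bar>coeff (coeff F j) i :: int\<bar>))"
proof (rule finite_subset)
  let ?g = "\<lambda>(i, j). \<bar>coeff (coeff F j) i\<bar>"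
  let ?S = "{(i, j). coeff (coeff F j) i \<noteq> 0}"
  show "range ?g \<subseteq> insert 0 (?g ` ?S)"
  proof
    fix v assume "v \<in> range ?g"
    then obtain i j where "v = \<bar>coeff (coeff F j) i\<bar>" by auto
    then show "v \<in> insert 0 (?g ` ?S)"
      by (cases "coeff (coeff F j) i = 0") force+
  qed
  show "finite (insert 0 (?g ` ?S))" using finite_nonzero_bicoeffs[of F] by simp
qed

lemma eval_bipoly_altdef:
  "eval_bipoly F x y =
    (\<Sum>j\<le>degree F. (\<Sum>i\<le>degree (coeff F j). of_int (coeff (coeff F j) i) * x ^ i) * y ^ j)"
proof -
  have inner: "poly (map_poly of_int c) x = (\<Sum>i\<le>degree c. of_int (coeff c i) * x ^ i)"
    for c :: "int poly"
    by (simp add: poly_altdef degree_map_poly coeff_map_poly)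
  let ?q = "map_poly (\<lambda>c. poly (map_poly of_int c) x) F"
  have "poly ?q y = (\<Sum>j\<le>degree ?q. coeff ?q j * y ^ j)" by (rule poly_altdef)
  also have "\<dots> = (\<Sum>j\<le>degree F. coeff ?q j * y ^ j)"
    using degree_le[of "degree F" ?q]
    by (intro sum.mono_neutral_left) (auto simp: coeff_map_poly coeff_eq_0)
  finally show ?thesis by (simp add: eval_bipoly_def coeff_map_poly inner)
qed

end

theory Submission imports Defs begin

text \<open>
  Suppose \<open>r = \<bar>\<alpha>\<bar>\<close> exceeds the bound. As \<open>r\<close> is large compared with the height, a nonzero
  integer polynomial of height at most \<open>H\<close> is dominated at \<open>\<alpha>\<close> by its leading term. Hence
  \<open>\<bar>h(\<alpha>)\<bar>\<close> is close to \<open>r ^ \<delta>\<close>, and the nonzero coefficient polynomials of \<open>F\<close> in \<open>Y\<close> have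
  absolute value at least \<open>1\<close> at \<open>\<alpha>\<close>. With \<open>N = \<lfloor>2d/\<delta> + 1\<rfloor>\<close> we have \<open>N \<delta> \<ge> 2d + 1\<close>, so the
  term of order \<open>N\<close> of the exponential series makes \<open>exp \<bar>h(\<alpha>)\<bar>\<close> larger than \<open>d\<close> times any
  coefficient of \<open>F(\<alpha>, Y)\<close>. Then \<open>F(\<alpha>, exp (h(\<alpha>)))\<close> is dominated by its term of highest order
  in \<open>Y\<close> if \<open>h(\<alpha>) > 0\<close>, and by that of lowest order if \<open>h(\<alpha>) < 0\<close>, so it cannot vanish.
\<close>

section \<open>Coefficients, heights and degrees\<close>

lemma abs_coeff_le_height: "\<bar>coeff p i\<bar> \<le> height p"
  unfolding height_def by (rule Max_ge[OF finite_abs_coeffs]) simp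

lemma abs_coeff_le_height_bipoly: "\<bar>coeff (coeff F j) i\<bar> \<le> height_bipoly F"
  unfolding height_bipoly_def by (rule Max_ge[OF finite_abs_bicoeffs]) force

lemma le_total_degree:
  assumes "coeff (coeff F j) i \<noteq> 0"
  shows "i + j \<le> total_degree F"
  unfolding total_degree_def
  by (rule Max_ge) (use assms finite_total_degree_set[of F] in auto)

lemma degree_le_total_degree: "degree F \<le> total_degree F"
proof (cases "F = 0")
  case False
  then show ?thesis
    using le_total_degree[of F "degree F" "degree (lead_coeff F)"] by simp
qed simp

lemma degree_coeff_le_total_degree: "degree (coeff F j) \<le> total_degree F"
proof (cases "coeff F j = 0")
  case False
  then show ?thesis
    using le_total_degree[of F j "degree (coeff F j)"] by simp
qed simp

section \<open>Size of an integer polynomial at a point far from the origin\<close>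

lemma poly_of_int_altdef:
  "poly (map_poly of_int p) x = (\<Sum>i\<le>degree p. of_int (coeff p i) * x ^ i)"
  for x :: real
  by (simp add: poly_altdef degree_map_poly coeff_map_poly)

lemma sum_abs_le_geometric:
  fixes a :: "nat \<Rightarrow> real"
  assumes "\<And>i. \<bar>a i\<bar> \<le> H" "\<bar>x\<bar> \<ge> 1"
  shows "(\<bar>x\<bar> - 1) * \<bar>\<Sum>i<n. a i * x ^ i\<bar> \<le> H * (\<bar>x\<bar> ^ n - 1)"
proof -
  have "\<bar>\<Sum>i<n. a i * x ^ i\<bar> \<le> (\<Sum>i<n. \<bar>a i * x ^ i\<bar>)" by (rule sum_abs)
  also have "\<dots> \<le> (\<Sum>i<n. H * \<bar>x\<bar> ^ i)"
    by (intro sum_mono) (simp add: abs_mult power_abs assms mult_right_mono)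
  finally have "(\<bar>x\<bar> - 1) * \<bar>\<Sum>i<n. a i * x ^ i\<bar> \<le> (\<bar>x\<bar> - 1) * (\<Sum>i<n. H * \<bar>x\<bar> ^ i)"
    using assms by (intro mult_left_mono) auto
  also have "\<dots> = H * ((\<bar>x\<bar> - 1) * (\<Sum>i<n. \<bar>x\<bar> ^ i))"
    by (simp add: sum_distrib_left mult_ac)
  also have "\<dots> = H * (\<bar>x\<bar> ^ n - 1)"
    by (simp only: power_diff_1_eq)
  finally show ?thesis .
qed

lemma abs_poly_le:
  fixes x H :: real
  assumes H: "\<And>i. of_int \<bar>coeff p i\<bar> \<le> H" and x: "\<bar>x\<bar> \<ge> 1" and n: "degree p \<le> n"
  shows "(\<bar>x\<bar> - 1) * \<bar>poly (map_poly of_int p) x\<bar> \<le> H * \<bar>x\<bar> ^ Suc n"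
proof -
  have H0: "H \<ge> 0" using H[of 0] by linarith
  have "(\<bar>x\<bar> - 1) * \<bar>poly (map_poly of_int p) x\<bar> \<le> H * (\<bar>x\<bar> ^ Suc (degree p) - 1)"
    using sum_abs_le_geometric[of "\<lambda>i. of_int (coeff p i)" H x "Suc (degree p)"] H x
    by (simp only: poly_of_int_altdef lessThan_Suc_atMost) simp
  also have "\<dots> \<le> H * \<bar>x\<bar> ^ Suc n"
  proof (intro mult_left_mono H0)
    have "\<bar>x\<bar> ^ Suc (degree p) \<le> \<bar>x\<bar> ^ Suc n" using n x by (intro power_increasing) auto
    then show "\<bar>x\<bar> ^ Suc (degree p) - 1 \<le> \<bar>x\<bar> ^ Suc n" by simp
  qed
  finally show ?thesis .
qed

text \<open>A nonzero integer leading coefficient has absolute value at least 1, and the lower terms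
  form at most a geometric sum. The summand \<open>H\<close>, left over from that sum, is what later
  yields the exact lower bound 1.\<close>

lemma abs_poly_ge:
  fixes x H :: real
  assumes H: "\<And>i. of_int \<bar>coeff p i\<bar> \<le> H" and x: "\<bar>x\<bar> \<ge> 1" and p: "p \<noteq> 0"
  shows "\<bar>x\<bar> ^ degree p * (\<bar>x\<bar> - 1 - H) + H \<le> (\<bar>x\<bar> - 1) * \<bar>poly (map_poly of_int p) x\<bar>"
proof -
  let ?k = "degree p" and ?r = "\<bar>x\<bar>"
  let ?s = "\<Sum>i<degree p. of_int (coeff p i) * x ^ i"
  have lc: "\<bar>of_int (lead_coeff p) :: real\<bar> \<ge> 1"
  proof -
    have "\<bar>lead_coeff p\<bar> \<ge> 1" using p by (simp add: int_one_le_iff_zero_less)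
    then show ?thesis by linarith
  qed
  have "poly (map_poly of_int p) x = ?s + of_int (lead_coeff p) * x ^ ?k"
    by (simp add: poly_of_int_altdef flip: lessThan_Suc_atMost)
  then have "\<bar>of_int (lead_coeff p) * x ^ ?k\<bar> - \<bar>?s\<bar> \<le> \<bar>poly (map_poly of_int p) x\<bar>"
    by linarith
  moreover have "?r ^ ?k \<le> \<bar>of_int (lead_coeff p) * x ^ ?k\<bar>"
    using mult_right_mono[OF lc, of "?r ^ ?k"] by (simp add: abs_mult power_abs)
  ultimately have "?r ^ ?k - \<bar>?s\<bar> \<le> \<bar>poly (map_poly of_int p) x\<bar>" by linarith
  then have "(?r - 1) * (?r ^ ?k - \<bar>?s\<bar>) \<le> (?r - 1) * \<bar>poly (map_poly of_int p) x\<bar>"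
    using x by (intro mult_left_mono) auto
  moreover have "(?r - 1) * \<bar>?s\<bar> \<le> H * (?r ^ ?k - 1)"
    using H x by (intro sum_abs_le_geometric) auto
  ultimately show ?thesis by (simp add: algebra_simps)
qed

lemma abs_poly_ge_1:
  fixes x H :: real
  assumes H: "\<And>i. of_int \<bar>coeff p i\<bar> \<le> H" and x: "\<bar>x\<bar> > 1 + H" and p: "p \<noteq> 0"
  shows "1 \<le> \<bar>poly (map_poly of_int p) x\<bar>"
proof -
  have H0: "H \<ge> 0" using H[of 0] by linarith
  have "\<bar>x\<bar> - 1 - H \<le> \<bar>x\<bar> ^ degree p * (\<bar>x\<bar> - 1 - H)"
    using x H0 mult_right_mono[of 1 "\<bar>x\<bar> ^ degree p" "\<bar>x\<bar> - 1 - H"] by simp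
  then have "(\<bar>x\<bar> - 1) * 1 \<le> \<bar>x\<bar> ^ degree p * (\<bar>x\<bar> - 1 - H) + H" by simp
  also have "\<dots> \<le> (\<bar>x\<bar> - 1) * \<bar>poly (map_poly of_int p) x\<bar>"
    using x H0 by (intro abs_poly_ge[OF H _ p]) auto
  finally show ?thesis using x H0 by simp
qed

section \<open>Growth of the exponential against the coefficient polynomials\<close>

lemma power_div_fact_le_exp:
  fixes t :: real
  assumes "t \<ge> 0"
  shows "t ^ n / fact n \<le> exp t"
proof -
  have "(\<Sum>k\<in>{n}. t ^ k /\<^sub>R fact k) \<le> (\<Sum>k. t ^ k /\<^sub>R fact k)"
    using assms by (intro sum_le_suminf summable_exp_generic) auto
  then show ?thesis by (simp add: exp_def field_simps)
qed

text \<open>In a vanishing sum the term of index \<open>m\<close> must be cancelled by the other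
  \<open>n\<close> terms, each of which is smaller by the factor \<open>E\<close> up to its
  coefficient. Restricting \<open>dom\<close> to nonzero \<open>a j\<close> allows \<open>m\<close>
  to be the lowest index that occurs.\<close>

lemma zero_sum_imp_dominance_le:
  fixes a :: "nat \<Rightarrow> real"
  assumes zero: "(\<Sum>j\<le>n. a j * y ^ j) = 0" and y: "y > 0"
    and m: "m \<le> n" "\<bar>a m\<bar> \<ge> 1" and E: "E > 0"
    and K: "\<And>j. \<bar>a j\<bar> \<le> K"
    and dom: "\<And>j. j \<le> n \<Longrightarrow> j \<noteq> m \<Longrightarrow> a j \<noteq> 0 \<Longrightarrow> y ^ j * E \<le> y ^ m"
  shows "E \<le> real n * K"
proof -
  have K0: "K \<ge> 0" using K[of 0] by linarith
  let ?S = "{..n} - {m}"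
  have "a m * y ^ m = - (\<Sum>j\<in>?S. a j * y ^ j)"
    using zero m by (simp add: sum.remove[of "{..n}" m])
  then have "\<bar>a m\<bar> * y ^ m = \<bar>\<Sum>j\<in>?S. a j * y ^ j\<bar>"
    using y by (metis abs_minus_cancel abs_mult abs_of_pos zero_less_power)
  moreover have "1 * y ^ m \<le> \<bar>a m\<bar> * y ^ m" using m y by (intro mult_right_mono) auto
  ultimately have "y ^ m \<le> (\<Sum>j\<in>?S. \<bar>a j * y ^ j\<bar>)"
    using sum_abs[of "\<lambda>j. a j * y ^ j" ?S] by linarith
  then have "y ^ m * E \<le> (\<Sum>j\<in>?S. \<bar>a j * y ^ j\<bar>) * E" using E by (intro mult_right_mono) auto
  also have "\<dots> = (\<Sum>j\<in>?S. \<bar>a j\<bar> * (y ^ j * E))"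
    using y by (simp add: sum_distrib_left abs_mult mult_ac)
  also have "\<dots> \<le> (\<Sum>j\<in>?S. K * y ^ m)"
  proof (rule sum_mono)
    fix j assume j: "j \<in> ?S"
    show "\<bar>a j\<bar> * (y ^ j * E) \<le> K * y ^ m"
    proof (cases "a j = 0")
      case False
      then show ?thesis using j K[of j] K0 dom[of j] y E by (intro mult_mono) auto
    qed (use K0 y in simp)
  qed
  also have "\<dots> = y ^ m * (real n * K)" using m by simp
  finally show ?thesis using y by simp
qed

text \<open>Consecutive powers of \<open>exp t\<close> differ by the factor
  \<open>exp \<bar>t\<bar>\<close>, so this is the dominance factor of an extreme term: the highest
  for \<open>t \<ge> 0\<close>, the lowest for \<open>t < 0\<close>.\<close>

lemma exp_poly_bound:
  fixes F :: "int poly poly" and x t K :: real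
  defines "a \<equiv> \<lambda>j. poly (map_poly of_int (coeff F j)) x"
  assumes zero: "eval_bipoly F x (exp t) = 0" and F: "F \<noteq> 0"
    and lower: "\<And>j. coeff F j \<noteq> 0 \<Longrightarrow> \<bar>a j\<bar> \<ge> 1"
    and K: "\<And>j. \<bar>a j\<bar> \<le> K"
  shows "exp \<bar>t\<bar> \<le> real (degree F) * K"
proof -
  have sum0: "(\<Sum>j\<le>degree F. a j * exp t ^ j) = 0"
    using zero unfolding eval_bipoly_altdef a_def poly_of_int_altdef .
  have step: "exp t ^ j * exp \<bar>t\<bar> \<le> exp t ^ m"
    if "real j * t + \<bar>t\<bar> \<le> real m * t" for j m
    using that by (simp flip: exp_of_nat_mult exp_add)
  show ?thesis
  proof (cases "t \<ge> 0")
    case True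
    show ?thesis
    proof (rule zero_sum_imp_dominance_le[OF sum0 exp_gt_zero order_refl _ exp_gt_zero K])
      show "\<bar>a (degree F)\<bar> \<ge> 1" using F by (intro lower) simp
      fix j assume "j \<le> degree F" "j \<noteq> degree F"
      then have "real j + 1 \<le> real (degree F)" by linarith
      from mult_right_mono[OF this True]
      show "exp t ^ j * exp \<bar>t\<bar> \<le> exp t ^ degree F"
        using True by (intro step) (simp add: algebra_simps)
    qed
  next
    case False
    define l where "l = (LEAST j. coeff F j \<noteq> 0)"
    have "coeff F (degree F) \<noteq> 0" using F by simp
    then have l: "coeff F l \<noteq> 0" unfolding l_def by (rule LeastI)
    show ?thesis
    proof (rule zero_sum_imp_dominance_le[OF sum0 exp_gt_zero _ _ exp_gt_zero K])
      show "l \<le> degree F" using l by (rule le_degree)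
      show "\<bar>a l\<bar> \<ge> 1" using l by (rule lower)
      fix j assume "j \<noteq> l" "a j \<noteq> 0"
      \<comment> \<open>A nonzero value \<open>a j\<close> can only come from a nonzero coefficient
        polynomial.\<close>
      then have "l \<le> j" unfolding l_def by (intro Least_le) (auto simp: a_def)
      with \<open>j \<noteq> l\<close> have "real l + 1 \<le> real j" by linarith
      from mult_right_mono_neg[OF this, of t]
      show "exp t ^ j * exp \<bar>t\<bar> \<le> exp t ^ l"
        using False by (intro step) (simp add: algebra_simps)
    qed
  qed
qed

lemma exp_abs_poly_ge:
  fixes x H :: real
  assumes H: "\<And>i. of_int \<bar>coeff h i\<bar> \<le> H" and H0: "H > 0" and h: "h \<noteq> 0"
    and x: "\<bar>x\<bar> - 1 \<ge> 2 * real N * H" "\<bar>x\<bar> - 1 \<ge> H"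
  shows "\<bar>x\<bar> ^ (degree h * N) / (2 * fact N) \<le> exp \<bar>poly (map_poly of_int h) x\<bar>"
proof -
  let ?r = "\<bar>x\<bar>"
  \<comment> \<open>The lower terms of \<open>h\<close> amount to at most the fraction
    \<open>c\<close> of \<open>?r ^ degree h\<close>.\<close>
  define c where "c = H / (?r - 1)"
  have r: "?r - 1 > 0" using x H0 by linarith
  have c: "0 < c" "c \<le> 1" "real N * c \<le> 1 / 2"
    using r H0 x by (auto simp: c_def field_simps)
  let ?T = "?r ^ degree h * (1 - c)"
  have "(?r - 1) * ?T = ?r ^ degree h * (?r - 1 - H)"
    using r by (simp add: c_def field_simps)
  also have "\<dots> \<le> (?r - 1) * \<bar>poly (map_poly of_int h) x\<bar>"
    using abs_poly_ge[OF H _ h, of x] r H0 by linarith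
  finally have T: "?T \<le> \<bar>poly (map_poly of_int h) x\<bar>" using r by simp
  have T0: "?T \<ge> 0" using c by simp
  \<comment> \<open>Bernoulli gives \<open>1 - N * c\<close>, so raising to the power
    \<open>N\<close> loses only a factor 2; this is the 2 in \<open>2 * fact N\<close>.\<close>
  have "1 / 2 \<le> (1 - c) ^ N"
    using Bernoulli_inequality[of "-c" N] c by simp
  then have "?r ^ (degree h * N) * (1 / 2) \<le> ?r ^ (degree h * N) * (1 - c) ^ N"
    by (intro mult_left_mono) auto
  then have "?r ^ (degree h * N) * (1 / 2) \<le> ?T ^ N"
    by (simp add: power_mult_distrib power_mult)
  then have "?r ^ (degree h * N) * (1 / 2) / fact N \<le> ?T ^ N / fact N"
    by (intro divide_right_mono) auto
  also have "\<dots> \<le> exp ?T" by (rule power_div_fact_le_exp[OF T0])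
  also have "\<dots> \<le> exp \<bar>poly (map_poly of_int h) x\<bar>" using T by simp
  finally show ?thesis by simp
qed

theorem proposition23:
  fixes F :: "int poly poly" and h :: "int poly"
    and f :: "real \<Rightarrow> real"
    and d \<delta> :: nat and H \<alpha> :: real
  assumes f_def: "f = (\<lambda>x. eval_bipoly F x (exp (poly (map_poly of_int h) x)))"
    and "F \<noteq> 0"
    and "total_degree F \<le> d"
    and "degree h = \<delta>" and "\<delta> > 0"
    and "of_int (height_bipoly F) \<le> H" and "of_int (height h) \<le> H"
    and "f \<alpha> = 0"
  shows "\<bar>\<alpha>\<bar> \<le> 1 + (real d + 1) * H\<^sup>2 *
    max ((real d + 1) * (1 + 2 * H\<^sup>2))
        (2 * fact (nat \<lfloor>2 * real d / real \<delta> + 1\<rfloor>))"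
proof (rule ccontr)
  define N where "N = nat \<lfloor>2 * real d / real \<delta> + 1\<rfloor>"
  define r where "r = \<bar>\<alpha>\<bar>"
  let ?t = "poly (map_poly of_int h) \<alpha> :: real"
  assume "\<not> ?thesis"
  then have big: "(real d + 1) * H\<^sup>2 * max ((real d + 1) * (1 + 2 * H\<^sup>2)) (2 * fact N) < r - 1"
    by (simp add: N_def r_def)

  have h0: "h \<noteq> 0" using assms by auto
  have Hh: "of_int \<bar>coeff h i\<bar> \<le> H" for i
    using abs_coeff_le_height[of h i] \<open>of_int (height h) \<le> H\<close> by linarith
  have HF: "of_int \<bar>coeff (coeff F j) i\<bar> \<le> H" for i j
    using abs_coeff_le_height_bipoly[of F j i] \<open>of_int (height_bipoly F) \<le> H\<close> by linarith
  have "\<bar>lead_coeff h\<bar> \<ge> 1" using h0 by (simp add: int_one_le_iff_zero_less)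
  \<comment> \<open>This lets \<open>H\<close> replace \<open>H\<^sup>2\<close> in the bound, and 3
    replace \<open>1 + 2 * H\<^sup>2\<close>.\<close>
  then have H1: "H \<ge> 1" using Hh[of "degree h"] by linarith
  then have H2: "H \<le> H\<^sup>2" by (simp add: power2_eq_square)

  have Nle: "N \<le> 2 * d + 1"
  proof -
    have "2 * real d / real \<delta> \<le> 2 * real d"
      using \<open>\<delta> > 0\<close> divide_left_mono[of 1 "real \<delta>" "2 * real d"] by simp
    then show ?thesis unfolding N_def by linarith
  qed
  \<comment> \<open>The \<open>+ 1\<close> under the floor makes \<open>N\<close> exceed
    \<open>2 * d / \<delta>\<close> strictly, and integrality then gains a full power of
    \<open>r\<close>.\<close>
  have Nge: "2 * d + 1 \<le> \<delta> * N"
  proof -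
    have "2 * real d / real \<delta> < real N"
      unfolding N_def by linarith
    then have "real (2 * d) < real (\<delta> * N)" using \<open>\<delta> > 0\<close> by (simp add: field_simps)
    then show ?thesis by linarith
  qed

  \<comment> \<open>The second entry of the maximum serves the final contradiction; the first one,
    in \<open>big2\<close>, makes \<open>r\<close> large enough for the estimates of
    \<open>h\<close> and of the coefficients of \<open>F\<close>.\<close>
  have big1: "(real d + 1) * H * (2 * fact N) < r - 1"
  proof -
    have "(real d + 1) * H * (2 * fact N) \<le>
        (real d + 1) * H\<^sup>2 * max ((real d + 1) * (1 + 2 * H\<^sup>2)) (2 * fact N)"
      using H1 H2 by (intro mult_mono) auto
    then show ?thesis using big by linarith
  qed
  have big2: "3 * (real d + 1)\<^sup>2 * H < r - 1"
  proof -
    have "(real d + 1) * H * ((real d + 1) * 3) \<le>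
        (real d + 1) * H\<^sup>2 * max ((real d + 1) * (1 + 2 * H\<^sup>2)) (2 * fact N)"
      using H1 H2 by (intro mult_mono max.coboundedI1) auto
    moreover have "(real d + 1) * H * ((real d + 1) * 3) = 3 * (real d + 1)\<^sup>2 * H"
      by (simp only: power2_eq_square mult_ac)
    ultimately show ?thesis using big by linarith
  qed
  have "1 \<le> (real d + 1)\<^sup>2" by simp
  then have "H \<le> (real d + 1)\<^sup>2 * H" using H1 by (simp add: mult_le_cancel_right1)
  then have rH: "H < r - 1" using big2 H1 by linarith
  then have r: "r > 1" using H1 by linarith
  have "2 * real N \<le> 4 * real d + 2" using Nle by linarith
  also have "\<dots> \<le> 3 * (real d + 1)\<^sup>2"
    using zero_le_power2[of "real d"] by (simp add: power2_sum)
  finally have "2 * real N * H \<le> 3 * (real d + 1)\<^sup>2 * H" using H1 by (intro mult_right_mono) auto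
  then have "2 * real N * H \<le> r - 1" using big2 by linarith
  then have "r ^ (\<delta> * N) / (2 * fact N) \<le> exp \<bar>?t\<bar>"
    using exp_abs_poly_ge[OF Hh _ h0, where x = \<alpha> and N = N] H1 rH \<open>degree h = \<delta>\<close>
    by (simp add: r_def)
  moreover have "r ^ (2 * d + 1) / (2 * fact N) \<le> r ^ (\<delta> * N) / (2 * fact N)"
    using Nge r by (intro divide_right_mono power_increasing) auto
  ultimately have lower: "r ^ (2 * d + 1) / (2 * fact N) \<le> exp \<bar>?t\<bar>" by linarith

  let ?K = "H * r ^ Suc d / (r - 1)"
  have "exp \<bar>?t\<bar> \<le> real (degree F) * ?K"
  proof (rule exp_poly_bound)
    show "eval_bipoly F \<alpha> (exp ?t) = 0" using \<open>f \<alpha> = 0\<close> f_def by simp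
    show "F \<noteq> 0" by fact
    show "1 \<le> \<bar>poly (map_poly of_int (coeff F j)) \<alpha>\<bar>" if "coeff F j \<noteq> 0" for j
      using that HF rH by (intro abs_poly_ge_1[of _ H]) (auto simp: r_def)
    show "\<bar>poly (map_poly of_int (coeff F j)) \<alpha>\<bar> \<le> ?K" for j
    proof -
      have "degree (coeff F j) \<le> d"
        using degree_coeff_le_total_degree[of F j] \<open>total_degree F \<le> d\<close> by linarith
      then have "(r - 1) * \<bar>poly (map_poly of_int (coeff F j)) \<alpha>\<bar> \<le> H * r ^ Suc d"
        using abs_poly_le[of "coeff F j" H \<alpha> d] HF r by (simp add: r_def)
      then show ?thesis using r by (simp add: field_simps)
    qed
  qed
  also have "\<dots> \<le> real d * ?K"
    using degree_le_total_degree[of F] \<open>total_degree F \<le> d\<close> H1 r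
    by (intro mult_right_mono) auto
  finally have "r ^ (2 * d + 1) / (2 * fact N) \<le> real d * ?K" using lower by linarith
  then have "r ^ (2 * d + 1) * (r - 1) \<le> real d * H * r ^ Suc d * (2 * fact N)"
    using r by (simp add: field_simps)
  also have "\<dots> = r ^ Suc d * (real d * H * (2 * fact N))" by simp
  also have "r ^ (2 * d + 1) * (r - 1) = r ^ Suc d * (r ^ d * (r - 1))"
    by (simp add: power_add mult_2)
  finally have upper: "r ^ d * (r - 1) \<le> real d * H * (2 * fact N)" using r by simp
  \<comment> \<open>Cancelling \<open>r ^ Suc d\<close> has left the factor \<open>r ^ d\<close>,
    which is at least 1, also for \<open>d = 0\<close>.\<close>
  have "r - 1 \<le> r ^ d * (r - 1)"
    using r mult_right_mono[of 1 "r ^ d" "r - 1"] by simp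
  also note upper
  also have "real d * H * (2 * fact N) \<le> (real d + 1) * H * (2 * fact N)"
    using H1 by (intro mult_right_mono) auto
  also note big1
  finally show False by simp
qed

end
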